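(* Let $\delta=(\lambda,v)$ be a non-degenerate purely balanced tangent to the symmetrized bidisc $G$, and let $\omega_1,\omega_2$ be the two points $\omega\in\mathbb{T}$ for which $\Phi_\omega$ solves the Carathéodory extremal problem $\mathrm{Car}\,\delta$. For $j=1,2$ let $m_j\in\mathrm{Aut}\,\mathbb{D}$ be such that $m_j\circ\Phi_{\omega_j}$ is well aligned at $\delta$, and let $\varphi_j=m_j\circ\Phi_{\omega_j}$. Then for any $\psi\in\mathcal{S}(G)$ and any $r\in[0,1]$ the function $$F = r\varphi_1+(1-r)\varphi_2 + r(1-r)\,\frac{(\varphi_1-\varphi_2)^2\psi}{1-[(1-r)\varphi_1+r\varphi_2]\psi}$$ is a Carathéodory extremal function for $\delta$ and is well aligned at $\delta$.
   Context: $\mathbb{D}$ is the open unit disc, $\mathbb{T}$ the unit circle, $\mathrm{Aut}\,\mathbb{D}$ the group of holomorphic automorphisms of $\mathbb{D}$. The symmetrized bidisc is the domain $G=\{(z+w,zw): |z|<1,\ |w|<1\}\subset\mathbb{C}^2$, whose points are written $(s,p)$. $\mathrm{Hol}(G,\mathbb{D})$ is the set of holomorphic maps $G\to\mathbb{D}$; the Schur class $\mathcal{S}(G)$ is the set of holomorphic maps from $G$ to the closed unit disc. A tangent to $G$ is a pair $\delta=(\lambda,v)$ with $\lambda\in G$, $v\in\mathbb{C}^2$; it is nondegenerate if $v\neq0$. With $D_vF(\lambda)$ the directional derivative of $F$ at $\lambda$ in the direction $v$, put $$|\delta|_{\rm car}=\sup_{F\in\mathrm{Hol}(G,\mathbb{D})}\frac{|D_vF(\lambda)|}{1-|F(\lambda)|^2}.$$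 A function $F\in\mathrm{Hol}(G,\mathbb{D})$ is a Carathéodory extremal function for $\delta$ (equivalently, $F$ solves $\mathrm{Car}\,\delta$) if the supremum is attained at $F$. A Carathéodory extremal function $F$ for $\delta$ is well aligned at $\delta$ if $F(\lambda)=0$ and $D_vF(\lambda)>0$ (equivalently $F(\lambda)=0$ and $D_vF(\lambda)=|\delta|_{\rm car}$). For $\omega\in\mathbb{T}$, $\Phi_\omega\in\mathrm{Hol}(G,\mathbb{D})$ is given by $\Phi_\omega(s,p)=\dfrac{2\omega p-s}{2-\omega s}$. A nondegenerate tangent $\delta$ is purely balanced if $\Phi_\omega$ solves $\mathrm{Car}\,\delta$ for exactly two values of $\omega$ in $\mathbb{T}$. *)

theory Defs
  imports "HOL-Complex_Analysis.Complex_Analysis"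
begin

type_synonym tangent = "(complex \<times> complex) \<times> (complex \<times> complex)"

definition cscale :: "complex \<Rightarrow> complex \<times> complex \<Rightarrow> complex \<times> complex" where
  "cscale c v = (c * fst v, c * snd v)"

text \<open>
  Holomorphy in two variables on an open set: real Frechet differentiability at every
  point with a complex-linear derivative. (The library predicate \<open>holomorphic_on\<close> only
  covers one variable.)
\<close>

definition holomorphic2_on :: "(complex \<times> complex \<Rightarrow> complex) \<Rightarrow> (complex \<times> complex) set \<Rightarrow> bool" where
  "holomorphic2_on F U \<longleftrightarrow>
     (\<forall>x\<in>U. \<exists>F'. (F has_derivative F') (at x) \<and> (\<forall>c v. F' (cscale c v) = c * F' v))"

definition dir_deriv :: "complex \<times> complex \<Rightarrow> (complex \<times> complex \<Rightarrow> complex) \<Rightarrow> complex \<times> complex \<Rightarrow> complex" where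
  "dir_deriv v F x = deriv (\<lambda>t. F (x + cscale t v)) 0"

definition symm_bidisc :: "(complex \<times> complex) set" where
  "symm_bidisc = {(z + w, z * w) | z w. norm z < 1 \<and> norm w < 1}"

text \<open>
  Maps on the symmetrized bidisc are total functions of which only the values on
  \<open>symm_bidisc\<close> matter.
\<close>

definition hol_G_disc :: "(complex \<times> complex \<Rightarrow> complex) set" where
  "hol_G_disc = {F. holomorphic2_on F symm_bidisc \<and> F ` symm_bidisc \<subseteq> ball 0 1}"

definition schur_class :: "(complex \<times> complex \<Rightarrow> complex) set" where
  "schur_class = {F. holomorphic2_on F symm_bidisc \<and> F ` symm_bidisc \<subseteq> cball 0 1}"

definition aut_disc :: "(complex \<Rightarrow> complex) set" where
  "aut_disc = {m. m holomorphic_on ball 0 1 \<and> bij_betw m (ball 0 1) (ball 0 1) \<and>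
                  inv_into (ball 0 1) m holomorphic_on ball 0 1}"

definition is_tangent :: "tangent \<Rightarrow> bool" where
  "is_tangent \<delta> \<longleftrightarrow> fst \<delta> \<in> symm_bidisc"

definition nondegenerate :: "tangent \<Rightarrow> bool" where
  "nondegenerate \<delta> \<longleftrightarrow> snd \<delta> \<noteq> 0"

definition car_quot :: "(complex \<times> complex \<Rightarrow> complex) \<Rightarrow> tangent \<Rightarrow> real" where
  "car_quot F \<delta> = norm (dir_deriv (snd \<delta>) F (fst \<delta>)) / (1 - (norm (F (fst \<delta>)))\<^sup>2)"

text \<open>
  For a tangent the supremum is over a nonempty set that is bounded above (the symmetrized
  bidisc is open, so the Schwarz-Pick lemma applies on a disc in the direction of the
  tangent), hence the supremum in the reals is the true one.
\<close>

definition car_norm :: "tangent \<Rightarrow> real" where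
  "car_norm \<delta> = (SUP F\<in>hol_G_disc. car_quot F \<delta>)"

definition car_extremal :: "(complex \<times> complex \<Rightarrow> complex) \<Rightarrow> tangent \<Rightarrow> bool" where
  "car_extremal F \<delta> \<longleftrightarrow> F \<in> hol_G_disc \<and> car_quot F \<delta> = car_norm \<delta>"

definition well_aligned :: "(complex \<times> complex \<Rightarrow> complex) \<Rightarrow> tangent \<Rightarrow> bool" where
  "well_aligned F \<delta> \<longleftrightarrow> car_extremal F \<delta> \<and> F (fst \<delta>) = 0 \<and>
     dir_deriv (snd \<delta>) F (fst \<delta>) \<in> \<real> \<and> Re (dir_deriv (snd \<delta>) F (fst \<delta>)) > 0"

definition Phi :: "complex \<Rightarrow> complex \<times> complex \<Rightarrow> complex" where
  "Phi \<omega> = (\<lambda>(s, p). (2 * \<omega> * p - s) / (2 - \<omega> * s))"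

definition purely_balanced :: "tangent \<Rightarrow> bool" where
  "purely_balanced \<delta> \<longleftrightarrow> is_tangent \<delta> \<and> nondegenerate \<delta> \<and>
     card {\<omega> \<in> sphere 0 1. car_extremal (Phi \<omega>) \<delta>} = 2"

end

theory Submission
  imports Defs
begin

text \<open>
  At the base point \<open>\<phi>1\<close> and \<open>\<phi>2\<close> vanish and have the same derivative along the tangent,
  so the last summand of \<open>F\<close> vanishes there to second order and \<open>F\<close> inherits value and
  derivative. What remains is that \<open>F\<close> maps into the open disc. This is because \<open>F\<close> is the
  linear fractional transformation of \<open>\<psi>\<close> whose coefficient matrix is the conjugate of
  \<open>diag (\<phi>1, \<phi>2)\<close>, a strict contraction, by the reflection with rows
  \<open>(sqrt r, sqrt (1 - r))\<close> and \<open>(sqrt (1 - r), - sqrt r)\<close>.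
\<close>

text \<open>The real matrix with rows (p, q) and (q, -p) is orthogonal, hence an isometry of C^2; in
  real and imaginary parts the cross terms cancel.\<close>

lemma norm_reflection:
  fixes x y :: complex and p q :: real
  assumes "p\<^sup>2 + q\<^sup>2 = 1"
  shows "(norm (of_real p * x + of_real q * y))\<^sup>2 + (norm (of_real q * x - of_real p * y))\<^sup>2
         = (norm x)\<^sup>2 + (norm y)\<^sup>2"
proof -
  have "(norm (of_real p * x + of_real q * y))\<^sup>2 + (norm (of_real q * x - of_real p * y))\<^sup>2
        = (p\<^sup>2 + q\<^sup>2) * ((norm x)\<^sup>2 + (norm y)\<^sup>2)"
    unfolding cmod_power2 by simp algebra
  with assms show ?thesis by simp
qed

text \<open>With p^2 = r and q^2 = 1 - r this is A + B z C / (1 - D z), where A = p^2 a + q^2 b, B =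
  C = p q (a - b) and D = q^2 a + p^2 b are the entries of the conjugated matrix. Taking numbers for
  the values of the functions makes the disc bound a pointwise claim.\<close>

definition lft :: "real \<Rightarrow> complex \<Rightarrow> complex \<Rightarrow> complex \<Rightarrow> complex" where
  "lft r a b z = of_real r * a + (1 - of_real r) * b
     + of_real r * (1 - of_real r) *
       ((a - b)\<^sup>2 * z / (1 - ((1 - of_real r) * a + of_real r * b) * z))"

text \<open>A convex combination of \<open>a\<close> and \<open>b\<close> stays in the open disc,
  and a factor \<open>z\<close> of modulus at most 1 cannot bring it to 1.\<close>

lemma lft_denominator_nonzero:
  fixes a b z :: complex and r :: real
  assumes "norm a < 1" "norm b < 1" "norm z \<le> 1" "0 \<le> r" "r \<le> 1"
  shows "1 - ((1 - of_real r) * a + of_real r * b) * z \<noteq> 0"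
proof -
  have "norm ((1 - r) *\<^sub>R a + r *\<^sub>R b) < 1"
    using convexD_alt[OF convex_ball[of "0::complex" 1], of a b r] assms by simp
  then have "norm ((1 - of_real r) * a + of_real r * b) < 1"
    by (simp add: scaleR_conv_of_real)
  moreover have "norm (((1 - of_real r) * a + of_real r * b) * z)
                 \<le> norm ((1 - of_real r) * a + of_real r * b)"
    using assms(3) by (simp add: norm_mult mult_left_le)
  ultimately show ?thesis
    by (metis eq_iff_diff_eq_0 norm_one not_less)
qed

lemma norm_lft_less_one:
  fixes a b z :: complex and r :: real
  assumes "norm a < 1" "norm b < 1" "norm z \<le> 1" "0 \<le> r" "r \<le> 1"
  shows "norm (lft r a b z) < 1"
proof -
  define p q where "p = sqrt r" and "q = sqrt (1 - r)"
  have pq: "p\<^sup>2 = r" "q\<^sup>2 = 1 - r" using assms by (auto simp: p_def q_def)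
  \<comment> \<open>With both weights written as products, the identities below are polynomial in p
    and q. \<open>r'_eq\<close> is unfolded first, since \<open>r_eq\<close> would destroy its
    left-hand side.\<close>
  have r_eq: "complex_of_real r = of_real p * of_real p"
    unfolding of_real_mult[symmetric] pq(1)[symmetric] power2_eq_square ..
  have "1 - complex_of_real r = of_real (1 - r)" by simp
  also have "\<dots> = of_real q * of_real q"
    unfolding of_real_mult[symmetric] pq(2)[symmetric] power2_eq_square ..
  finally have r'_eq: "1 - complex_of_real r = of_real q * of_real q" .
  define D where "D = 1 - ((1 - of_real r) * a + of_real r * b) * z"
  have D: "D \<noteq> 0" using lft_denominator_nonzero[OF assms] by (simp add: D_def)
  \<comment> \<open>\<open>y\<close> solves the feedback equation y = C + D u with u = z y, for the
    matrix entries C and D above. Thus the matrix sends (1, u) to (\<open>lft r a b z\<close>, y),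
    and (\<alpha>, \<beta>) is the reflection of (1, u).\<close>
  define y where "y = of_real (p * q) * (a - b) / D"
  define u where "u = z * y"
  define \<alpha> \<beta> where "\<alpha> = of_real p * 1 + of_real q * u" and "\<beta> = of_real q * 1 - of_real p * u"
  have F: "lft r a b z = of_real p * (a * \<alpha>) + of_real q * (b * \<beta>)"
  proof -
    have "of_real r * (1 - of_real r) * ((a - b)\<^sup>2 * z / D) = of_real (p * q) * (a - b) * u"
      unfolding u_def y_def r'_eq unfolding r_eq by (simp add: power2_eq_square)
    then have "lft r a b z = of_real r * a + (1 - of_real r) * b + of_real (p * q) * (a - b) * u"
      unfolding lft_def D_def by (rule arg_cong)
    then show ?thesis
      unfolding \<alpha>_def \<beta>_def r'_eq unfolding r_eq by (simp add: algebra_simps)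
  qed
  have Y: "y = of_real q * (a * \<alpha>) - of_real p * (b * \<beta>)"
  proof -
    have "y * D = of_real (p * q) * (a - b)" using D by (simp add: y_def)
    then have "y = of_real (p * q) * (a - b) + ((1 - of_real r) * a + of_real r * b) * u"
      by (simp add: D_def u_def algebra_simps)
    then show ?thesis
      unfolding \<alpha>_def \<beta>_def r'_eq unfolding r_eq by (simp add: algebra_simps)
  qed
  have pq1: "p\<^sup>2 + q\<^sup>2 = 1" using pq by simp
  have out: "(norm (lft r a b z))\<^sup>2 + (norm y)\<^sup>2 = (norm (a * \<alpha>))\<^sup>2 + (norm (b * \<beta>))\<^sup>2"
    unfolding F by (subst Y) (rule norm_reflection[OF pq1])
  have inp: "(norm \<alpha>)\<^sup>2 + (norm \<beta>)\<^sup>2 = 1 + (norm u)\<^sup>2"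
    unfolding \<alpha>_def \<beta>_def by (subst norm_reflection[OF pq1]) simp
  \<comment> \<open>One of \<alpha>, \<beta> may vanish, and then only the other coordinate shrinks
    strictly.\<close>
  have strict: "(norm (c * x))\<^sup>2 < (norm x)\<^sup>2" if "norm c < 1" "x \<noteq> 0" for c x :: complex
    using that by (intro power_strict_mono) (auto simp: norm_mult)
  have nonstrict: "(norm (c * x))\<^sup>2 \<le> (norm x)\<^sup>2" if "norm c < 1" for c x :: complex
    using less_imp_le[OF strict[of c x]] that by (cases "x = 0") simp_all
  have "\<alpha> \<noteq> 0 \<or> \<beta> \<noteq> 0"
  proof (rule ccontr)
    assume "\<not> ?thesis"
    with inp have "1 + (norm u)\<^sup>2 = 0" by simp
    then show False using zero_le_power2[of "norm u"] by linarith
  qed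
  then have "(norm (a * \<alpha>))\<^sup>2 + (norm (b * \<beta>))\<^sup>2 < (norm \<alpha>)\<^sup>2 + (norm \<beta>)\<^sup>2"
    using strict nonstrict assms(1,2) by (metis add_le_less_mono add_less_le_mono)
  moreover have "(norm u)\<^sup>2 \<le> (norm y)\<^sup>2"
    unfolding u_def using assms(3) by (intro power_mono) (auto simp: norm_mult mult_left_le_one_le)
  \<comment> \<open>With L = \<open>lft r a b z\<close>: |L|^2 + |y|^2 < 1 + |u|^2 \<le> 1 + |y|^2,
    and |y|^2 cancels.\<close>
  ultimately have "(norm (lft r a b z))\<^sup>2 < 1" using out inp by linarith
  then show ?thesis by (simp add: power_less_one_iff abs_square_less_1)
qed

lemma holomorphic2_on_const: "holomorphic2_on (\<lambda>x. c) U"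
  unfolding holomorphic2_on_def by (auto intro!: exI[of _ "\<lambda>x. 0"])

lemma holomorphic2_on_add:
  assumes "holomorphic2_on f U" "holomorphic2_on g U"
  shows "holomorphic2_on (\<lambda>x. f x + g x) U"
  unfolding holomorphic2_on_def
proof
  fix x assume "x \<in> U"
  with assms obtain f' g' where
    f: "(f has_derivative f') (at x)" "\<And>c v. f' (cscale c v) = c * f' v" and
    g: "(g has_derivative g') (at x)" "\<And>c v. g' (cscale c v) = c * g' v"
    unfolding holomorphic2_on_def by metis
  show "\<exists>F'. ((\<lambda>x. f x + g x) has_derivative F') (at x) \<and> (\<forall>c v. F' (cscale c v) = c * F' v)"
    by (rule exI, rule conjI, rule has_derivative_add[OF f(1) g(1)])
       (simp add: f(2) g(2) algebra_simps)
qed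

lemma holomorphic2_on_mult:
  assumes "holomorphic2_on f U" "holomorphic2_on g U"
  shows "holomorphic2_on (\<lambda>x. f x * g x) U"
  unfolding holomorphic2_on_def
proof
  fix x assume "x \<in> U"
  with assms obtain f' g' where
    f: "(f has_derivative f') (at x)" "\<And>c v. f' (cscale c v) = c * f' v" and
    g: "(g has_derivative g') (at x)" "\<And>c v. g' (cscale c v) = c * g' v"
    unfolding holomorphic2_on_def by metis
  show "\<exists>F'. ((\<lambda>x. f x * g x) has_derivative F') (at x) \<and> (\<forall>c v. F' (cscale c v) = c * F' v)"
    by (rule exI, rule conjI, rule has_derivative_mult[OF f(1) g(1)])
       (simp add: f(2) g(2) algebra_simps)
qed

lemma holomorphic2_on_diff:
  assumes "holomorphic2_on f U" "holomorphic2_on g U"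
  shows "holomorphic2_on (\<lambda>x. f x - g x) U"
  using holomorphic2_on_add[OF assms(1) holomorphic2_on_mult[OF holomorphic2_on_const[of "-1"] assms(2)]]
  by simp

lemma holomorphic2_on_inverse:
  assumes "holomorphic2_on f U" "\<And>x. x \<in> U \<Longrightarrow> f x \<noteq> 0"
  shows "holomorphic2_on (\<lambda>x. inverse (f x)) U"
  unfolding holomorphic2_on_def
proof
  fix x assume x: "x \<in> U"
  with assms obtain f' where
    f: "(f has_derivative f') (at x)" "\<And>c v. f' (cscale c v) = c * f' v"
    unfolding holomorphic2_on_def by metis
  show "\<exists>F'. ((\<lambda>x. inverse (f x)) has_derivative F') (at x) \<and> (\<forall>c v. F' (cscale c v) = c * F' v)"
    by (rule exI, rule conjI, rule Deriv.has_derivative_inverse[OF assms(2)[OF x] f(1)])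
       (simp add: f(2) algebra_simps)
qed

lemma holomorphic2_on_lft:
  assumes "holomorphic2_on f U" "holomorphic2_on g U" "holomorphic2_on h U"
    and "\<And>x. x \<in> U \<Longrightarrow> 1 - ((1 - of_real r) * f x + of_real r * g x) * h x \<noteq> 0"
  shows "holomorphic2_on (\<lambda>x. lft r (f x) (g x) (h x)) U"
  unfolding lft_def divide_inverse power2_eq_square
  by (intro holomorphic2_on_add holomorphic2_on_mult holomorphic2_on_diff
      holomorphic2_on_inverse holomorphic2_on_const assms)

text \<open>Complex linearity turns the real derivative along the line into a complex one. So the
  \<open>deriv\<close> in \<open>dir_deriv\<close> is a genuine derivative, and the one-variable
  rules apply to it.\<close>

lemma holomorphic2_on_line:
  assumes "holomorphic2_on F U" "x \<in> U"
  shows "((\<lambda>t. F (x + cscale t v)) has_field_derivative dir_deriv v F x) (at 0)"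
proof -
  obtain F' where F': "(F has_derivative F') (at x)" "\<And>c v. F' (cscale c v) = c * F' v"
    using assms unfolding holomorphic2_on_def by metis
  have "((\<lambda>t. x + cscale t v) has_derivative (\<lambda>t. cscale t v)) (at 0)"
    unfolding cscale_def by (auto intro!: derivative_eq_intros)
  \<comment> \<open>The chain rule asks for the derivative at the image of t = 0, which is
    \<open>x\<close>.\<close>
  moreover have "(F has_derivative F') (at (x + cscale 0 v))"
    using F'(1) by (simp add: cscale_def zero_prod_def[symmetric])
  ultimately have "((\<lambda>t. F (x + cscale t v)) has_derivative (\<lambda>t. F' (cscale t v))) (at 0)"
    by (rule has_derivative_compose)
  then have "((\<lambda>t. F (x + cscale t v)) has_field_derivative F' v) (at 0)"
    by (simp add: has_field_derivative_def F'(2) mult_commute_abs)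
  then show ?thesis unfolding dir_deriv_def by (simp add: DERIV_imp_deriv)
qed

lemma dir_deriv_lft_at_zero:
  assumes "holomorphic2_on f U" "holomorphic2_on g U" "holomorphic2_on h U" "x \<in> U"
    and "f x = 0" "g x = 0"
  shows "dir_deriv v (\<lambda>x. lft r (f x) (g x) (h x)) x
         = of_real r * dir_deriv v f x + (1 - of_real r) * dir_deriv v g x"
proof -
  have "x + cscale 0 v = x" by (simp add: cscale_def zero_prod_def[symmetric])
  \<comment> \<open>At t = 0 the denominator is 1, so the quotient rule applies, and the square of
    the difference has a double zero.\<close>
  then have "((\<lambda>t. lft r (f (x + cscale t v)) (g (x + cscale t v)) (h (x + cscale t v)))
      has_field_derivative of_real r * dir_deriv v f x + (1 - of_real r) * dir_deriv v g x) (at 0)"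
    unfolding lft_def using assms(5,6)
    by (auto intro!: derivative_eq_intros holomorphic2_on_line[OF assms(1,4)]
        holomorphic2_on_line[OF assms(2,4)] holomorphic2_on_line[OF assms(3,4)])
  then show ?thesis unfolding dir_deriv_def[of v "\<lambda>x. lft r (f x) (g x) (h x)"]
    by (rule DERIV_imp_deriv)
qed

text \<open>Where \<open>F\<close> vanishes the denominator of \<open>car_quot\<close> is 1, and a
  positive real derivative equals its modulus. In this form the derivative condition passes to
  convex combinations without evaluating the supremum.\<close>

lemma well_aligned_iff:
  "well_aligned F \<delta> \<longleftrightarrow> F \<in> hol_G_disc \<and> F (fst \<delta>) = 0 \<and>
     dir_deriv (snd \<delta>) F (fst \<delta>) = of_real (car_norm \<delta>) \<and> 0 < car_norm \<delta>"
  unfolding well_aligned_def car_extremal_def car_quot_def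
  by (auto elim!: Reals_cases)

theorem theorem3p1:
  fixes \<delta> :: tangent and \<omega>1 \<omega>2 :: complex
    and m1 m2 :: "complex \<Rightarrow> complex"
    and \<phi>1 \<phi>2 \<psi> F :: "complex \<times> complex \<Rightarrow> complex"
    and r :: real
  assumes "is_tangent \<delta>" and "nondegenerate \<delta>" and "purely_balanced \<delta>"
    and "\<omega>1 \<noteq> \<omega>2"
    and "{\<omega> \<in> sphere 0 1. car_extremal (Phi \<omega>) \<delta>} = {\<omega>1, \<omega>2}"
    and "m1 \<in> aut_disc" and "well_aligned (m1 \<circ> Phi \<omega>1) \<delta>"
    and "m2 \<in> aut_disc" and "well_aligned (m2 \<circ> Phi \<omega>2) \<delta>"
    and "\<phi>1 = m1 \<circ> Phi \<omega>1" and "\<phi>2 = m2 \<circ> Phi \<omega>2"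
    and "\<psi> \<in> schur_class"
    and "0 \<le> r" and "r \<le> 1"
    and "F = (\<lambda>x. of_real r * \<phi>1 x + (1 - of_real r) * \<phi>2 x
               + of_real r * (1 - of_real r) *
                 ((\<phi>1 x - \<phi>2 x)\<^sup>2 * \<psi> x /
                  (1 - ((1 - of_real r) * \<phi>1 x + of_real r * \<phi>2 x) * \<psi> x)))"
  shows "car_extremal F \<delta> \<and> well_aligned F \<delta>"
proof -
  have x: "fst \<delta> \<in> symm_bidisc" using assms(1) by (simp add: is_tangent_def)
  have \<phi>1: "holomorphic2_on \<phi>1 symm_bidisc" "\<And>x. x \<in> symm_bidisc \<Longrightarrow> norm (\<phi>1 x) < 1"
      "\<phi>1 (fst \<delta>) = 0" "dir_deriv (snd \<delta>) \<phi>1 (fst \<delta>) = of_real (car_norm \<delta>)" "0 < car_norm \<delta>"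
    using assms(7,10) by (auto simp: well_aligned_iff hol_G_disc_def)
  have \<phi>2: "holomorphic2_on \<phi>2 symm_bidisc" "\<And>x. x \<in> symm_bidisc \<Longrightarrow> norm (\<phi>2 x) < 1"
      "\<phi>2 (fst \<delta>) = 0" "dir_deriv (snd \<delta>) \<phi>2 (fst \<delta>) = of_real (car_norm \<delta>)"
    using assms(9,11) by (auto simp: well_aligned_iff hol_G_disc_def)
  have \<psi>: "holomorphic2_on \<psi> symm_bidisc" "\<And>x. x \<in> symm_bidisc \<Longrightarrow> norm (\<psi> x) \<le> 1"
    using assms(12) by (auto simp: schur_class_def)
  have F: "F = (\<lambda>x. lft r (\<phi>1 x) (\<phi>2 x) (\<psi> x))" unfolding assms(15) lft_def ..
  have "F \<in> hol_G_disc"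
    unfolding F hol_G_disc_def
    using holomorphic2_on_lft[OF \<phi>1(1) \<phi>2(1) \<psi>(1) lft_denominator_nonzero]
      norm_lft_less_one[OF \<phi>1(2) \<phi>2(2) \<psi>(2)] \<phi>1(2) \<phi>2(2) \<psi>(2) assms(13,14)
    by auto
  moreover have "F (fst \<delta>) = 0" by (simp add: F lft_def \<phi>1 \<phi>2)
  \<comment> \<open>Both derivatives equal the Caratheodory norm, and the weights r and 1 - r add up
    to 1.\<close>
  moreover have "dir_deriv (snd \<delta>) F (fst \<delta>) = of_real (car_norm \<delta>)"
    unfolding F
    by (subst dir_deriv_lft_at_zero[OF \<phi>1(1) \<phi>2(1) \<psi>(1) x \<phi>1(3) \<phi>2(3)])
       (simp add: \<phi>1 \<phi>2 algebra_simps)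
  ultimately have "well_aligned F \<delta>" using \<phi>1(5) by (simp add: well_aligned_iff)
  then show ?thesis by (simp add: well_aligned_def)
qed

end
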